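(* Let $\nabla,\nabla^*$ be $g$-dual connections on a (pseudo-)Riemannian manifold $(M,g)$ and let $\nabla^{(0)}=\frac12(\nabla+\nabla^* )$ be the average connection. Then for all vector fields $X,Y,Z$ on $M$: (i) $$\begin{aligned}R(X,Y)Z&=R^{(0)}(X,Y)Z-\tfrac12\big\{(\nabla^{(0)}_XK)(Y,Z)-(\nabla^{(0)}_YK)(X,Z)-\tfrac12[K_X,K_Y]Z\big\}-\tfrac12K(T^{(0)}(X,Y),Z)\\&=R^{(0)}(X,Y)Z-\tfrac12\big\{(\nabla_XK)(Y,Z)-(\nabla_YK)(X,Z)+\tfrac12[K_X,K_Y]Z\big\}-\tfrac12K(T(X,Y),Z);\end{aligned}$$ (ii) $$\begin{aligned}R^*(X,Y)Z&=R^{(0)}(X,Y)Z+\tfrac12\big\{(\nabla^{(0)}_XK)(Y,Z)-(\nabla^{(0)}_YK)(X,Z)+\tfrac12[K_X,K_Y]Z\big\}+\tfrac12K(T^{(0)}(X,Y),Z)\\&=R^{(0)}(X,Y)Z+\tfrac12\big\{(\nabla_XK)(Y,Z)-(\nabla_YK)(X,Z)+\tfrac32[K_X,K_Y]Z\big\}+\tfrac12K(T(X,Y),Z);\end{aligned}$$ (iii) $$\begin{aligned}R(X,Y)Z-R^*(X,Y)Z&=-\big\{(\nabla^{(0)}_XK)(Y,Z)-(\nabla^{(0)}_YK)(X,Z)\big\}-K(T^{(0)}(X,Y),Z)\\&=-\big\{(\nabla_XK)(Y,Z)-(\nabla_YK)(X,Z)+[K_X,K_Y]Z\big\}-K(T(X,Y),Z);\end{aligned}$$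 (iv) $$R(X,Y)Z+R^*(X,Y)Z=2R^{(0)}(X,Y)Z+\tfrac12[K_X,K_Y]Z.$$
   Context: Connections are affine connections, possibly with torsion. $\nabla$ and $\nabla^*$ are $g$-dual if $X(g(Y,Z))=g(\nabla_XY,Z)+g(Y,\nabla^*_XZ)$ for all vector fields. The difference tensor is $K_XY=K(X,Y)=\nabla^*_XY-\nabla_XY$, and $[K_X,K_Y]Z=K(X,K(Y,Z))-K(Y,K(X,Z))$. The covariant derivative of $K$ is $(\nabla_XK)(Y,Z)=\nabla_X(K(Y,Z))-K(\nabla_XY,Z)-K(Y,\nabla_XZ)$ (similarly for $\nabla^{(0)}$). Torsion: $T(X,Y)=\nabla_XY-\nabla_YX-[X,Y]$; curvature: $R(X,Y)Z=\nabla_X\nabla_YZ-\nabla_Y\nabla_XZ-\nabla_{[X,Y]}Z$. $R,T$ belong to $\nabla$; $R^*$ to $\nabla^*$; $R^{(0)},T^{(0)}$ to $\nabla^{(0)}$. *)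

theory Defs
  imports "HOL-Analysis.Analysis" "HOL-Library.Function_Algebras"
begin

text \<open>Functions form a real vector space pointwise, extending the pointwise ring structure of
  \<^theory>\<open>HOL-Library.Function_Algebras\<close>.  It is used both for real functions on a manifold and
  for vector fields.\<close>

instantiation "fun" :: (type, real_vector) real_vector
begin

definition scaleR_fun :: "real \<Rightarrow> ('a \<Rightarrow> 'b) \<Rightarrow> 'a \<Rightarrow> 'b"
  where "scaleR_fun c f = (\<lambda>x. c *\<^sub>R f x)"

instance
  by standard (simp_all add: scaleR_fun_def fun_eq_iff algebra_simps)

end

section \<open>Smooth manifolds\<close>

text \<open>\<open>C\<^sup>k\<close> and smooth maps on an open subset \<open>S\<close> of a Euclidean space: a map is \<open>C\<^sup>k\<^sup>+\<^sup>1\<close> if it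
  is differentiable on \<open>S\<close> and all its directional derivatives are \<open>C\<^sup>k\<close>.\<close>

fun Ck_on :: "nat \<Rightarrow> 'e::euclidean_space set \<Rightarrow> ('e \<Rightarrow> 'b::real_normed_vector) \<Rightarrow> bool"
  where
    "Ck_on 0 S f \<longleftrightarrow> continuous_on S f"
  | "Ck_on (Suc k) S f \<longleftrightarrow>
       (\<exists>f'. (\<forall>x\<in>S. (f has_derivative f' x) (at x)) \<and> (\<forall>v. Ck_on k S (\<lambda>x. f' x v)))"

definition smooth_on :: "'e::euclidean_space set \<Rightarrow> ('e \<Rightarrow> 'b::real_normed_vector) \<Rightarrow> bool"
  where "smooth_on S f \<longleftrightarrow> (\<forall>k. Ck_on k S f)"

text \<open>A chart is a pair \<open>(U, \<phi>)\<close>; only the values of \<open>\<phi>\<close> on \<open>U\<close> matter, and its inverse is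
  \<open>inv_into U \<phi>\<close>.  The set \<open>\<A>\<close> is an atlas, not necessarily a maximal one.\<close>

locale smooth_manifold =
  fixes M :: "'a topology"
    and \<A> :: "('a set \<times> ('a \<Rightarrow> 'e::euclidean_space)) set"
  assumes Hausdorff: "Hausdorff_space M"
    and second_countable: "second_countable M"
    and chart_domain: "(U, \<phi>) \<in> \<A> \<Longrightarrow> openin M U"
    and chart_image: "(U, \<phi>) \<in> \<A> \<Longrightarrow> open (\<phi> ` U)"
    and chart_homeo: "(U, \<phi>) \<in> \<A> \<Longrightarrow> homeomorphic_map (subtopology M U) (top_of_set (\<phi> ` U)) \<phi>"
    and charts_cover: "(\<Union>(U, \<phi>)\<in>\<A>. U) = topspace M"
    and charts_compatible:
      "(U, \<phi>) \<in> \<A> \<Longrightarrow> (V, \<psi>) \<in> \<A> \<Longrightarrow> smooth_on (\<phi> ` (U \<inter> V)) (\<psi> \<circ> inv_into U \<phi>)"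

text \<open>Total functions represent functions on \<open>M\<close>; so that equality of these means equality on
  \<open>M\<close>, smooth functions, tangent vectors and vector fields are normalised to be zero outside
  their proper domain.\<close>

definition smooth_functions ::
    "'a topology \<Rightarrow> ('a set \<times> ('a \<Rightarrow> 'e::euclidean_space)) set \<Rightarrow> ('a \<Rightarrow> real) set"
  where "smooth_functions M \<A> =
    {f. (\<forall>(U, \<phi>)\<in>\<A>. smooth_on (\<phi> ` U) (f \<circ> inv_into U \<phi>)) \<and> (\<forall>p. p \<notin> topspace M \<longrightarrow> f p = 0)}"

definition tangent_space ::
    "'a topology \<Rightarrow> ('a set \<times> ('a \<Rightarrow> 'e::euclidean_space)) set \<Rightarrow> 'a \<Rightarrow> (('a \<Rightarrow> real) \<Rightarrow> real) set"
  where "tangent_space M \<A> p =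
    {v. (\<forall>f\<in>smooth_functions M \<A>. \<forall>h\<in>smooth_functions M \<A>. v (f + h) = v f + v h) \<and>
        (\<forall>c. \<forall>f\<in>smooth_functions M \<A>. v (c *\<^sub>R f) = c * v f) \<and>
        (\<forall>f\<in>smooth_functions M \<A>. \<forall>h\<in>smooth_functions M \<A>. v (f * h) = f p * v h + h p * v f) \<and>
        (\<forall>f. f \<notin> smooth_functions M \<A> \<longrightarrow> v f = 0)}"

text \<open>A vector field \<open>X\<close> assigns to each point \<open>p\<close> a tangent vector \<open>X p\<close>, that is, a derivation
  at \<open>p\<close>.\<close>

type_synonym 'a vfield = "'a \<Rightarrow> ('a \<Rightarrow> real) \<Rightarrow> real"

definition vf_apply :: "'a vfield \<Rightarrow> ('a \<Rightarrow> real) \<Rightarrow> 'a \<Rightarrow> real"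
  where "vf_apply X f = (\<lambda>p. X p f)"

definition vector_fields ::
    "'a topology \<Rightarrow> ('a set \<times> ('a \<Rightarrow> 'e::euclidean_space)) set \<Rightarrow> 'a vfield set"
  where "vector_fields M \<A> =
    {X. (\<forall>p\<in>topspace M. X p \<in> tangent_space M \<A> p) \<and> (\<forall>p. p \<notin> topspace M \<longrightarrow> X p = 0) \<and>
        (\<forall>f\<in>smooth_functions M \<A>. vf_apply X f \<in> smooth_functions M \<A>)}"

definition vf_mult :: "('a \<Rightarrow> real) \<Rightarrow> 'a vfield \<Rightarrow> 'a vfield"
  where "vf_mult f X = (\<lambda>p. f p *\<^sub>R X p)"

definition lie_bracket :: "'a vfield \<Rightarrow> 'a vfield \<Rightarrow> 'a vfield"
  where "lie_bracket X Y = (\<lambda>p f. X p (vf_apply Y f) - Y p (vf_apply X f))"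

section \<open>Metrics and connections\<close>

definition metric_apply ::
    "('a \<Rightarrow> (('a \<Rightarrow> real) \<Rightarrow> real) \<Rightarrow> (('a \<Rightarrow> real) \<Rightarrow> real) \<Rightarrow> real) \<Rightarrow>
      'a vfield \<Rightarrow> 'a vfield \<Rightarrow> 'a \<Rightarrow> real"
  where "metric_apply g X Y = (\<lambda>p. g p (X p) (Y p))"

text \<open>A pseudo-Riemannian metric is a smooth symmetric nondegenerate \<open>(0,2)\<close>-tensor field; this
  includes the Riemannian metrics.  The index is not required to be the same on different
  connected components.\<close>

locale pseudo_riemannian_manifold = smooth_manifold M \<A>
  for M :: "'a topology" and \<A> :: "('a set \<times> ('a \<Rightarrow> 'e::euclidean_space)) set" +
  fixes g :: "'a \<Rightarrow> (('a \<Rightarrow> real) \<Rightarrow> real) \<Rightarrow> (('a \<Rightarrow> real) \<Rightarrow> real) \<Rightarrow> real"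
  assumes metric_add:
      "p \<in> topspace M \<Longrightarrow> u \<in> tangent_space M \<A> p \<Longrightarrow> v \<in> tangent_space M \<A> p \<Longrightarrow>
        w \<in> tangent_space M \<A> p \<Longrightarrow> g p (u + v) w = g p u w + g p v w"
    and metric_scale:
      "p \<in> topspace M \<Longrightarrow> u \<in> tangent_space M \<A> p \<Longrightarrow> w \<in> tangent_space M \<A> p \<Longrightarrow>
        g p (c *\<^sub>R u) w = c * g p u w"
    and metric_sym:
      "p \<in> topspace M \<Longrightarrow> u \<in> tangent_space M \<A> p \<Longrightarrow> w \<in> tangent_space M \<A> p \<Longrightarrow>
        g p u w = g p w u"
    and metric_nondegenerate:
      "p \<in> topspace M \<Longrightarrow> u \<in> tangent_space M \<A> p \<Longrightarrow>
        (\<And>w. w \<in> tangent_space M \<A> p \<Longrightarrow> g p u w = 0) \<Longrightarrow> u = 0"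
    and metric_smooth:
      "X \<in> vector_fields M \<A> \<Longrightarrow> Y \<in> vector_fields M \<A> \<Longrightarrow>
        metric_apply g X Y \<in> smooth_functions M \<A>"

definition affine_connection ::
    "'a topology \<Rightarrow> ('a set \<times> ('a \<Rightarrow> 'e::euclidean_space)) set \<Rightarrow>
      ('a vfield \<Rightarrow> 'a vfield \<Rightarrow> 'a vfield) \<Rightarrow> bool"
  where "affine_connection M \<A> D \<longleftrightarrow>
    (\<forall>X\<in>vector_fields M \<A>. \<forall>Y\<in>vector_fields M \<A>. D X Y \<in> vector_fields M \<A>) \<and>
    (\<forall>X\<in>vector_fields M \<A>. \<forall>X'\<in>vector_fields M \<A>. \<forall>Y\<in>vector_fields M \<A>.
       D (X + X') Y = D X Y + D X' Y) \<and>
    (\<forall>f\<in>smooth_functions M \<A>. \<forall>X\<in>vector_fields M \<A>. \<forall>Y\<in>vector_fields M \<A>.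
       D (vf_mult f X) Y = vf_mult f (D X Y)) \<and>
    (\<forall>X\<in>vector_fields M \<A>. \<forall>Y\<in>vector_fields M \<A>. \<forall>Y'\<in>vector_fields M \<A>.
       D X (Y + Y') = D X Y + D X Y') \<and>
    (\<forall>c. \<forall>X\<in>vector_fields M \<A>. \<forall>Y\<in>vector_fields M \<A>. D X (c *\<^sub>R Y) = c *\<^sub>R D X Y) \<and>
    (\<forall>f\<in>smooth_functions M \<A>. \<forall>X\<in>vector_fields M \<A>. \<forall>Y\<in>vector_fields M \<A>.
       D X (vf_mult f Y) = vf_mult (vf_apply X f) Y + vf_mult f (D X Y))"

definition dual_connections ::
    "'a topology \<Rightarrow> ('a set \<times> ('a \<Rightarrow> 'e::euclidean_space)) set \<Rightarrow>
      ('a \<Rightarrow> (('a \<Rightarrow> real) \<Rightarrow> real) \<Rightarrow> (('a \<Rightarrow> real) \<Rightarrow> real) \<Rightarrow> real) \<Rightarrow>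
      ('a vfield \<Rightarrow> 'a vfield \<Rightarrow> 'a vfield) \<Rightarrow> ('a vfield \<Rightarrow> 'a vfield \<Rightarrow> 'a vfield) \<Rightarrow> bool"
  where "dual_connections M \<A> g D D' \<longleftrightarrow>
    (\<forall>X\<in>vector_fields M \<A>. \<forall>Y\<in>vector_fields M \<A>. \<forall>Z\<in>vector_fields M \<A>.
       vf_apply X (metric_apply g Y Z) = metric_apply g (D X Y) Z + metric_apply g Y (D' X Z))"

definition average_connection ::
    "('a vfield \<Rightarrow> 'a vfield \<Rightarrow> 'a vfield) \<Rightarrow> ('a vfield \<Rightarrow> 'a vfield \<Rightarrow> 'a vfield) \<Rightarrow>
      'a vfield \<Rightarrow> 'a vfield \<Rightarrow> 'a vfield"
  where "average_connection D D' X Y = (1/2) *\<^sub>R (D X Y + D' X Y)"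

definition difference_tensor ::
    "('a vfield \<Rightarrow> 'a vfield \<Rightarrow> 'a vfield) \<Rightarrow> ('a vfield \<Rightarrow> 'a vfield \<Rightarrow> 'a vfield) \<Rightarrow>
      'a vfield \<Rightarrow> 'a vfield \<Rightarrow> 'a vfield"
  where "difference_tensor D D' X Y = D' X Y - D X Y"

definition torsion ::
    "('a vfield \<Rightarrow> 'a vfield \<Rightarrow> 'a vfield) \<Rightarrow> 'a vfield \<Rightarrow> 'a vfield \<Rightarrow> 'a vfield"
  where "torsion D X Y = D X Y - D Y X - lie_bracket X Y"

definition curvature ::
    "('a vfield \<Rightarrow> 'a vfield \<Rightarrow> 'a vfield) \<Rightarrow> 'a vfield \<Rightarrow> 'a vfield \<Rightarrow> 'a vfield \<Rightarrow> 'a vfield"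
  where "curvature D X Y Z = D X (D Y Z) - D Y (D X Z) - D (lie_bracket X Y) Z"

definition cov_deriv ::
    "('a vfield \<Rightarrow> 'a vfield \<Rightarrow> 'a vfield) \<Rightarrow> ('a vfield \<Rightarrow> 'a vfield \<Rightarrow> 'a vfield) \<Rightarrow>
      'a vfield \<Rightarrow> 'a vfield \<Rightarrow> 'a vfield \<Rightarrow> 'a vfield"
  where "cov_deriv D K X Y Z = D X (K Y Z) - K (D X Y) Z - K Y (D X Z)"

text \<open>\<open>commutator K X Y Z\<close> is \<open>[K\<^sub>X, K\<^sub>Y] Z\<close>.\<close>

definition commutator ::
    "('a vfield \<Rightarrow> 'a vfield \<Rightarrow> 'a vfield) \<Rightarrow> 'a vfield \<Rightarrow> 'a vfield \<Rightarrow> 'a vfield \<Rightarrow> 'a vfield"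
  where "commutator K X Y Z = K X (K Y Z) - K Y (K X Z)"

end

theory Submission
  imports Defs
begin

text \<open>Along the affine line of connections \<open>D + c K\<close> the curvature is a quadratic polynomial in
  \<open>c\<close>: expanding \<open>(D\<^sub>X + c K\<^sub>X)(D\<^sub>Y + c K\<^sub>Y) Z\<close> antisymmetrically gives the curvature of \<open>D\<close> as
  the constant term and \<open>[K\<^sub>X, K\<^sub>Y] Z\<close> as the quadratic coefficient, while the linear coefficient is
  \<open>(D\<^sub>X K)(Y, Z) - (D\<^sub>Y K)(X, Z) + K(T\<^sup>D(X, Y), Z)\<close>.  The torsion enters because the covariant
  derivatives of \<open>K\<close> contribute \<open>- K(D\<^sub>X Y - D\<^sub>Y X, Z)\<close>, whereas the curvature only contains
  \<open>- K([X, Y], Z)\<close>.  This is the lemma \<open>curvature_add_scaled\<close>.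

  The average connection and the two dual ones lie on one such line.  Based at the average, \<open>D\<close>
  and its dual have \<open>c = -1/2\<close> and \<open>c = 1/2\<close>, which yields the identities in terms of the
  average.  Based at \<open>D\<close>, its dual has \<open>c = 1\<close>; comparing this expansion with
  the previous two expresses the linear coefficient at the average through the one at \<open>D\<close> and
  \<open>[K\<^sub>X, K\<^sub>Y] Z\<close>, and so turns the first form of each identity into the second.

  What remains is to see that every vector field occurring in the expansion is a genuine smooth
  vector field, since a connection is only additive on those.  The Lie bracket is the interesting
  case: its derivation property needs products of smooth functions to be smooth.\<close>

section \<open>The algebra of smooth functions\<close>

lemma Ck_on_const: "Ck_on k S (\<lambda>x. c)"
proof (induction k arbitrary: c)
  case (Suc k)
  then show ?case
    by (auto intro!: exI[of _ "\<lambda>x v. 0"])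
qed simp

lemma Ck_on_Suc_imp: "Ck_on (Suc k) S f \<Longrightarrow> Ck_on k S f"
proof (induction k arbitrary: f)
  case 0
  then obtain f' where "\<And>x. x \<in> S \<Longrightarrow> (f has_derivative f' x) (at x)"
    by auto
  then show ?case
    by (auto intro!: continuous_at_imp_continuous_on intro: has_derivative_continuous)
next
  case (Suc k)
  then obtain f' where f': "\<And>x. x \<in> S \<Longrightarrow> (f has_derivative f' x) (at x)"
    and "\<And>v. Ck_on (Suc k) S (\<lambda>x. f' x v)"
    by (subst (asm) Ck_on.simps(2)) blast
  then have "\<And>v. Ck_on k S (\<lambda>x. f' x v)"
    using Suc.IH by blast
  then show ?case
    using f' by auto
qed

lemma Ck_on_add:
  "Ck_on k S f \<Longrightarrow> Ck_on k S h \<Longrightarrow> Ck_on k S (\<lambda>x. f x + h x)"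
proof (induction k arbitrary: f h)
  case 0
  then show ?case
    by (simp add: continuous_on_add)
next
  case (Suc k)
  obtain f' where f': "\<And>x. x \<in> S \<Longrightarrow> (f has_derivative f' x) (at x)"
    "\<And>v. Ck_on k S (\<lambda>x. f' x v)"
    using Suc.prems(1) by auto
  obtain h' where h': "\<And>x. x \<in> S \<Longrightarrow> (h has_derivative h' x) (at x)"
    "\<And>v. Ck_on k S (\<lambda>x. h' x v)"
    using Suc.prems(2) by auto
  show ?case
    unfolding Ck_on.simps
    using f' h' Suc.IH
    by (intro exI[of _ "\<lambda>x v. f' x v + h' x v"]) (auto intro: has_derivative_add)
qed

text \<open>The product rule leaves \<open>f\<close> and \<open>h\<close> undifferentiated next to \<open>h'\<close> and \<open>f'\<close>, so the
  induction uses them at the lower order as well, by \<open>Ck_on_Suc_imp\<close>.\<close>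

lemma Ck_on_mult:
  fixes f h :: "'e::euclidean_space \<Rightarrow> real"
  shows "Ck_on k S f \<Longrightarrow> Ck_on k S h \<Longrightarrow> Ck_on k S (\<lambda>x. f x * h x)"
proof (induction k arbitrary: f h)
  case 0
  then show ?case
    by (simp add: continuous_on_mult)
next
  case (Suc k)
  obtain f' where f': "\<And>x. x \<in> S \<Longrightarrow> (f has_derivative f' x) (at x)"
    "\<And>v. Ck_on k S (\<lambda>x. f' x v)"
    using Suc.prems(1) by auto
  obtain h' where h': "\<And>x. x \<in> S \<Longrightarrow> (h has_derivative h' x) (at x)"
    "\<And>v. Ck_on k S (\<lambda>x. h' x v)"
    using Suc.prems(2) by auto
  have "Ck_on k S f" "Ck_on k S h"
    using Suc.prems Ck_on_Suc_imp by blast+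
  then have "\<And>v. Ck_on k S (\<lambda>x. f x * h' x v + f' x v * h x)"
    using f'(2) h'(2) Suc.IH by (intro Ck_on_add) auto
  then show ?case
    unfolding Ck_on.simps
    using f'(1) h'(1)
    by (intro exI[of _ "\<lambda>x v. f x * h' x v + f' x v * h x"]) (auto intro: has_derivative_mult)
qed

lemma smooth_functions_zero: "0 \<in> smooth_functions M \<A>"
  by (auto simp: smooth_functions_def smooth_on_def o_def intro: Ck_on_const)

lemma smooth_functions_add:
  "f \<in> smooth_functions M \<A> \<Longrightarrow> h \<in> smooth_functions M \<A> \<Longrightarrow> f + h \<in> smooth_functions M \<A>"
  by (auto simp: smooth_functions_def smooth_on_def o_def intro!: Ck_on_add)

lemma smooth_functions_mult:
  "f \<in> smooth_functions M \<A> \<Longrightarrow> h \<in> smooth_functions M \<A> \<Longrightarrow> f * h \<in> smooth_functions M \<A>"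
  by (auto simp: smooth_functions_def smooth_on_def o_def intro!: Ck_on_mult)

lemma smooth_functions_scaleR:
  "f \<in> smooth_functions M \<A> \<Longrightarrow> c *\<^sub>R f \<in> smooth_functions M \<A>"
  by (auto simp: smooth_functions_def smooth_on_def o_def scaleR_fun_def
      intro!: Ck_on_mult Ck_on_const)

lemma smooth_functions_diff:
  assumes "f \<in> smooth_functions M \<A>" "h \<in> smooth_functions M \<A>"
  shows "f - h \<in> smooth_functions M \<A>"
  using smooth_functions_add[OF assms(1) smooth_functions_scaleR[OF assms(2), of "-1"]] by simp

section \<open>Closure properties of vector fields\<close>

lemma tangent_space_add:
  "u \<in> tangent_space M \<A> p \<Longrightarrow> v \<in> tangent_space M \<A> p \<Longrightarrow> u + v \<in> tangent_space M \<A> p"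
  by (auto simp: tangent_space_def algebra_simps)

lemma tangent_space_scaleR:
  "v \<in> tangent_space M \<A> p \<Longrightarrow> c *\<^sub>R v \<in> tangent_space M \<A> p"
  by (auto simp: tangent_space_def scaleR_fun_def algebra_simps)

lemma vector_fields_add:
  assumes "X \<in> vector_fields M \<A>" "Y \<in> vector_fields M \<A>"
  shows "X + Y \<in> vector_fields M \<A>"
proof -
  have "vf_apply (X + Y) f = vf_apply X f + vf_apply Y f" for f
    by (simp add: vf_apply_def fun_eq_iff)
  then show ?thesis
    using assms by (auto simp: vector_fields_def tangent_space_add smooth_functions_add)
qed

lemma vector_fields_scaleR:
  assumes "X \<in> vector_fields M \<A>"
  shows "c *\<^sub>R X \<in> vector_fields M \<A>"
proof -
  have "vf_apply (c *\<^sub>R X) f = c *\<^sub>R vf_apply X f" and "(c *\<^sub>R X) p = c *\<^sub>R X p" for f p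
    by (simp_all add: vf_apply_def scaleR_fun_def)
  then show ?thesis
    using assms by (auto simp: vector_fields_def tangent_space_scaleR smooth_functions_scaleR)
qed

lemma vector_fields_diff:
  assumes "X \<in> vector_fields M \<A>" "Y \<in> vector_fields M \<A>"
  shows "X - Y \<in> vector_fields M \<A>"
  using vector_fields_add[OF assms(1) vector_fields_scaleR[OF assms(2), of "-1"]] by simp

lemma vector_field_eq_0_outside:
  "X \<in> vector_fields M \<A> \<Longrightarrow> p \<notin> topspace M \<Longrightarrow> X p f = 0"
  by (simp add: vector_fields_def)

text \<open>Both sides vanish outside \<open>M\<close>, so the derivation laws hold at every point and can be used as
  equations between functions.\<close>

lemma
  assumes X: "X \<in> vector_fields M \<A>"
  shows vf_apply_smooth: "f \<in> smooth_functions M \<A> \<Longrightarrow> vf_apply X f \<in> smooth_functions M \<A>"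
    and vf_apply_add: "f \<in> smooth_functions M \<A> \<Longrightarrow> h \<in> smooth_functions M \<A> \<Longrightarrow>
      vf_apply X (f + h) = vf_apply X f + vf_apply X h"
    and vf_apply_scaleR: "f \<in> smooth_functions M \<A> \<Longrightarrow> vf_apply X (c *\<^sub>R f) = c *\<^sub>R vf_apply X f"
    and vf_apply_mult: "f \<in> smooth_functions M \<A> \<Longrightarrow> h \<in> smooth_functions M \<A> \<Longrightarrow>
      vf_apply X (f * h) = f * vf_apply X h + h * vf_apply X f"
    and vf_apply_not_smooth: "f \<notin> smooth_functions M \<A> \<Longrightarrow> vf_apply X f = 0"
proof -
  have T: "X p \<in> tangent_space M \<A> p" if "p \<in> topspace M" for p
    using X that by (simp add: vector_fields_def)
  have Z: "X p = 0" if "p \<notin> topspace M" for p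
    using X that by (simp add: vector_fields_def)
  show "vf_apply X f \<in> smooth_functions M \<A>" if "f \<in> smooth_functions M \<A>"
    using X that by (simp add: vector_fields_def)
  show "vf_apply X (f + h) = vf_apply X f + vf_apply X h"
    if "f \<in> smooth_functions M \<A>" "h \<in> smooth_functions M \<A>"
  proof
    fix p
    show "vf_apply X (f + h) p = (vf_apply X f + vf_apply X h) p"
      using that T[of p] Z[of p]
      by (cases "p \<in> topspace M") (auto simp: vf_apply_def tangent_space_def)
  qed
  show "vf_apply X (c *\<^sub>R f) = c *\<^sub>R vf_apply X f" if "f \<in> smooth_functions M \<A>"
  proof
    fix p
    have "X p (c *\<^sub>R f) = c * X p f"
      using that T[of p] Z[of p]
      by (cases "p \<in> topspace M") (auto simp: tangent_space_def)
    then show "vf_apply X (c *\<^sub>R f) p = (c *\<^sub>R vf_apply X f) p"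
      by (simp add: vf_apply_def scaleR_fun_def)
  qed
  show "vf_apply X (f * h) = f * vf_apply X h + h * vf_apply X f"
    if "f \<in> smooth_functions M \<A>" "h \<in> smooth_functions M \<A>"
  proof
    fix p
    show "vf_apply X (f * h) p = (f * vf_apply X h + h * vf_apply X f) p"
      using that T[of p] Z[of p]
      by (cases "p \<in> topspace M") (auto simp: vf_apply_def tangent_space_def)
  qed
  show "vf_apply X f = 0" if "f \<notin> smooth_functions M \<A>"
  proof
    fix p
    show "vf_apply X f p = 0 p"
      using that T[of p] Z[of p]
      by (cases "p \<in> topspace M") (auto simp: vf_apply_def tangent_space_def)
  qed
qed

lemma vf_apply_zero:
  "X \<in> vector_fields M \<A> \<Longrightarrow> vf_apply X 0 = 0"
  using vf_apply_scaleR[of X M \<A> 0 0] by (simp add: smooth_functions_zero)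

text \<open>The second-order terms of \<open>X(Y(f h))\<close> and \<open>Y(X(f h))\<close> are the symmetric expressions
  \<open>(X f)(Y h) + (X h)(Y f)\<close>, so they cancel in the bracket, which is therefore a derivation.\<close>

lemma vector_fields_lie_bracket:
  assumes X: "X \<in> vector_fields M \<A>" and Y: "Y \<in> vector_fields M \<A>"
  shows "lie_bracket X Y \<in> vector_fields M \<A>"
proof -
  let ?C = "smooth_functions M \<A>"
  have br: "vf_apply (lie_bracket X Y) f = vf_apply X (vf_apply Y f) - vf_apply Y (vf_apply X f)"
    for f
    by (simp add: vf_apply_def lie_bracket_def fun_eq_iff)
  have add: "vf_apply (lie_bracket X Y) (f + h)
      = vf_apply (lie_bracket X Y) f + vf_apply (lie_bracket X Y) h"
    if "f \<in> ?C" "h \<in> ?C" for f h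
    using that by (simp add: br vf_apply_add[OF X] vf_apply_add[OF Y]
        vf_apply_smooth[OF X] vf_apply_smooth[OF Y])
  have scale: "vf_apply (lie_bracket X Y) (c *\<^sub>R f) = c *\<^sub>R vf_apply (lie_bracket X Y) f"
    if "f \<in> ?C" for f c
    using that by (simp add: br vf_apply_scaleR[OF X] vf_apply_scaleR[OF Y]
        vf_apply_smooth[OF X] vf_apply_smooth[OF Y] scaleR_diff_right)
  have mult: "vf_apply (lie_bracket X Y) (f * h)
      = f * vf_apply (lie_bracket X Y) h + h * vf_apply (lie_bracket X Y) f"
    if "f \<in> ?C" "h \<in> ?C" for f h
    using that by (simp add: br vf_apply_add[OF X] vf_apply_add[OF Y] vf_apply_mult[OF X]
        vf_apply_mult[OF Y] vf_apply_smooth[OF X] vf_apply_smooth[OF Y] smooth_functions_mult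
        algebra_simps)
  have ns: "vf_apply (lie_bracket X Y) f = 0" if "f \<notin> ?C" for f
    using that by (simp add: br vf_apply_not_smooth[OF X] vf_apply_not_smooth[OF Y]
        vf_apply_zero[OF X] vf_apply_zero[OF Y])
  have at: "lie_bracket X Y p f = vf_apply (lie_bracket X Y) f p" for p f
    by (simp add: vf_apply_def)
  have "lie_bracket X Y p \<in> tangent_space M \<A> p" for p
    by (auto simp: tangent_space_def at add scale mult ns scaleR_fun_def[of _ "vf_apply _ _"])
  moreover have "lie_bracket X Y p = 0" if "p \<notin> topspace M" for p
    using that by (simp add: lie_bracket_def fun_eq_iff vector_field_eq_0_outside[OF X]
        vector_field_eq_0_outside[OF Y])
  moreover have "vf_apply (lie_bracket X Y) f \<in> ?C" if "f \<in> ?C" for f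
    using that by (simp add: br smooth_functions_diff vf_apply_smooth[OF X] vf_apply_smooth[OF Y])
  ultimately show ?thesis
    by (auto simp: vector_fields_def)
qed

section \<open>Lines of affine connections\<close>

lemma
  assumes "affine_connection M \<A> D"
    and "X \<in> vector_fields M \<A>" and "Y \<in> vector_fields M \<A>"
  shows affine_connection_closed: "D X Y \<in> vector_fields M \<A>"
    and affine_connection_add_left:
      "X' \<in> vector_fields M \<A> \<Longrightarrow> D (X + X') Y = D X Y + D X' Y"
    and affine_connection_add_right:
      "Y' \<in> vector_fields M \<A> \<Longrightarrow> D X (Y + Y') = D X Y + D X Y'"
    and affine_connection_scaleR_right: "D X (c *\<^sub>R Y) = c *\<^sub>R D X Y"
  using assms by (auto simp: affine_connection_def)

lemma affine_connection_diff_left: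
  assumes "affine_connection M \<A> D" "X \<in> vector_fields M \<A>" "X' \<in> vector_fields M \<A>"
    "Y \<in> vector_fields M \<A>"
  shows "D (X - X') Y = D X Y - D X' Y"
  using affine_connection_add_left[OF assms(1) vector_fields_diff[OF assms(2,3)] assms(4,3)]
  by simp

lemma affine_connection_average:
  assumes D: "affine_connection M \<A> D" and D': "affine_connection M \<A> D'"
  shows "affine_connection M \<A> (average_connection D D')"
proof -
  have mult_scale: "vf_mult f (c *\<^sub>R W) = c *\<^sub>R vf_mult f W" for f c and W :: "'a vfield"
    by (simp add: vf_mult_def scaleR_fun_def fun_eq_iff)
  have mult_add: "vf_mult f (V + W) = vf_mult f V + vf_mult f W" for f and V W :: "'a vfield"
    by (simp add: vf_mult_def fun_eq_iff scaleR_add_right)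
  have half: "(1/2) *\<^sub>R (W + U + (W + V)) = W + (1/2) *\<^sub>R (U + V)" for U V W :: "'a vfield"
    by (simp add: scaleR_fun_def fun_eq_iff field_simps)
  have leibniz: "average_connection D D' X (vf_mult f Y)
      = vf_mult (vf_apply X f) Y + vf_mult f (average_connection D D' X Y)"
    if "f \<in> smooth_functions M \<A>" "X \<in> vector_fields M \<A>" "Y \<in> vector_fields M \<A>" for f X Y
  proof -
    have "D X (vf_mult f Y) = vf_mult (vf_apply X f) Y + vf_mult f (D X Y)"
      and "D' X (vf_mult f Y) = vf_mult (vf_apply X f) Y + vf_mult f (D' X Y)"
      using assms that by (simp_all add: affine_connection_def)
    then show ?thesis
      by (simp only: average_connection_def half mult_scale mult_add)
  qed
  show ?thesis
    unfolding affine_connection_def[of M \<A> "average_connection D D'"]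
  proof (intro conjI ballI allI)
  qed (simp_all only: leibniz, insert assms, simp_all add: affine_connection_def
      average_connection_def vector_fields_add vector_fields_scaleR mult_scale mult_add
      scaleR_add_right add_ac)
qed

lemma
  assumes D: "affine_connection M \<A> D" and D': "affine_connection M \<A> D'"
    and X: "X \<in> vector_fields M \<A>" and Y: "Y \<in> vector_fields M \<A>"
  shows difference_tensor_closed: "difference_tensor D D' X Y \<in> vector_fields M \<A>"
    and difference_tensor_diff_left: "X' \<in> vector_fields M \<A> \<Longrightarrow>
      difference_tensor D D' (X - X') Y = difference_tensor D D' X Y - difference_tensor D D' X' Y"
    and difference_tensor_add_right: "Y' \<in> vector_fields M \<A> \<Longrightarrow>
      difference_tensor D D' X (Y + Y') = difference_tensor D D' X Y + difference_tensor D D' X Y'"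
    and difference_tensor_scaleR_right:
      "difference_tensor D D' X (c *\<^sub>R Y) = c *\<^sub>R difference_tensor D D' X Y"
  using assms
  by (simp_all add: difference_tensor_def vector_fields_diff
      affine_connection_closed[OF D] affine_connection_closed[OF D']
      affine_connection_diff_left[OF D] affine_connection_diff_left[OF D']
      affine_connection_add_right[OF D] affine_connection_add_right[OF D']
      affine_connection_scaleR_right[OF D] affine_connection_scaleR_right[OF D'] scaleR_diff_right)

text \<open>The summands \<open>K(D\<^sub>X Y, Z)\<close> and \<open>K(D\<^sub>Y X, Z)\<close> of the covariant derivatives cancel against
  the torsion term, which leaves \<open>- K([X, Y], Z)\<close>: up to the factor
  \<open>c\<close>, this is what replacing \<open>D\<close> by \<open>D'\<close> changes in the bracket term of the curvature.\<close>

lemma curvature_add_scaled: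
  assumes D: "affine_connection M \<A> D"
    and K_closed: "\<And>U V. U \<in> vector_fields M \<A> \<Longrightarrow> V \<in> vector_fields M \<A> \<Longrightarrow>
      K U V \<in> vector_fields M \<A>"
    and K_diff_left: "\<And>U U' V. U \<in> vector_fields M \<A> \<Longrightarrow> U' \<in> vector_fields M \<A> \<Longrightarrow>
      V \<in> vector_fields M \<A> \<Longrightarrow> K (U - U') V = K U V - K U' V"
    and K_add_right: "\<And>U V V'. U \<in> vector_fields M \<A> \<Longrightarrow> V \<in> vector_fields M \<A> \<Longrightarrow>
      V' \<in> vector_fields M \<A> \<Longrightarrow> K U (V + V') = K U V + K U V'"
    and K_scaleR_right: "\<And>U V. U \<in> vector_fields M \<A> \<Longrightarrow> V \<in> vector_fields M \<A> \<Longrightarrow>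
      K U (c *\<^sub>R V) = c *\<^sub>R K U V"
    and D': "\<And>U V. D' U V = D U V + c *\<^sub>R K U V"
    and X: "X \<in> vector_fields M \<A>" and Y: "Y \<in> vector_fields M \<A>"
    and Z: "Z \<in> vector_fields M \<A>"
  shows "curvature D' X Y Z = curvature D X Y Z
    + c *\<^sub>R (cov_deriv D K X Y Z - cov_deriv D K Y X Z + K (torsion D X Y) Z)
    + c\<^sup>2 *\<^sub>R commutator K X Y Z"
proof -
  note closed = X Y Z vector_fields_lie_bracket vector_fields_diff vector_fields_scaleR K_closed
    affine_connection_closed[OF D]
  have second: "D' U (D' V Z) = D U (D V Z) + c *\<^sub>R D U (K V Z)
      + (c *\<^sub>R K U (D V Z) + c\<^sup>2 *\<^sub>R K U (K V Z))"
    if "U \<in> vector_fields M \<A>" "V \<in> vector_fields M \<A>" for U V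
    using that by (simp add: D' closed K_add_right K_scaleR_right affine_connection_add_right[OF D]
        affine_connection_scaleR_right[OF D] scaleR_add_right power2_eq_square)
  have tors: "K (torsion D X Y) Z = K (D X Y) Z - K (D Y X) Z - K (lie_bracket X Y) Z"
    by (simp add: torsion_def K_diff_left closed)
  show ?thesis
    unfolding curvature_def second[OF X Y] second[OF Y X] D'[of "lie_bracket X Y"]
      cov_deriv_def commutator_def tors
    by (simp add: algebra_simps)
qed

section \<open>Curvatures of dual connections\<close>

theorem theorem2p12:
  fixes M :: "'a topology"
    and \<A> :: "('a set \<times> ('a \<Rightarrow> 'e::euclidean_space)) set"
    and g :: "'a \<Rightarrow> (('a \<Rightarrow> real) \<Rightarrow> real) \<Rightarrow> (('a \<Rightarrow> real) \<Rightarrow> real) \<Rightarrow> real"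
    and D Ds D0 K :: "'a vfield \<Rightarrow> 'a vfield \<Rightarrow> 'a vfield"
    and X Y Z :: "'a vfield"
  assumes "pseudo_riemannian_manifold M \<A> g"
    and "affine_connection M \<A> D"
    and "affine_connection M \<A> Ds"
    and "dual_connections M \<A> g D Ds"
    and "D0 = average_connection D Ds"
    and "K = difference_tensor D Ds"
    and "X \<in> vector_fields M \<A>" and "Y \<in> vector_fields M \<A>" and "Z \<in> vector_fields M \<A>"
  shows
    \<comment> \<open>(i)\<close>
    "(curvature D X Y Z = curvature D0 X Y Z
        - (1/2) *\<^sub>R (cov_deriv D0 K X Y Z - cov_deriv D0 K Y X Z - (1/2) *\<^sub>R commutator K X Y Z)
        - (1/2) *\<^sub>R K (torsion D0 X Y) Z \<and>
      curvature D X Y Z = curvature D0 X Y Z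
        - (1/2) *\<^sub>R (cov_deriv D K X Y Z - cov_deriv D K Y X Z + (1/2) *\<^sub>R commutator K X Y Z)
        - (1/2) *\<^sub>R K (torsion D X Y) Z) \<and>
     (curvature Ds X Y Z = curvature D0 X Y Z
        + (1/2) *\<^sub>R (cov_deriv D0 K X Y Z - cov_deriv D0 K Y X Z + (1/2) *\<^sub>R commutator K X Y Z)
        + (1/2) *\<^sub>R K (torsion D0 X Y) Z \<and>
      curvature Ds X Y Z = curvature D0 X Y Z
        + (1/2) *\<^sub>R (cov_deriv D K X Y Z - cov_deriv D K Y X Z + (3/2) *\<^sub>R commutator K X Y Z)
        + (1/2) *\<^sub>R K (torsion D X Y) Z) \<and>
     (curvature D X Y Z - curvature Ds X Y Z =
        - (cov_deriv D0 K X Y Z - cov_deriv D0 K Y X Z) - K (torsion D0 X Y) Z \<and>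
      curvature D X Y Z - curvature Ds X Y Z =
        - (cov_deriv D K X Y Z - cov_deriv D K Y X Z + commutator K X Y Z) - K (torsion D X Y) Z) \<and>
     curvature D X Y Z + curvature Ds X Y Z =
       2 *\<^sub>R curvature D0 X Y Z + (1/2) *\<^sub>R commutator K X Y Z"
proof -
  note D = \<open>affine_connection M \<A> D\<close> and Ds = \<open>affine_connection M \<A> Ds\<close>
    and K = \<open>K = difference_tensor D Ds\<close> and XYZ = assms(7-9)
  have D0: "affine_connection M \<A> D0"
    using affine_connection_average[OF D Ds] \<open>D0 = average_connection D Ds\<close> by simp
  have line: "curvature E' X Y Z = curvature E X Y Z
      + c *\<^sub>R (cov_deriv E K X Y Z - cov_deriv E K Y X Z + K (torsion E X Y) Z)
      + c\<^sup>2 *\<^sub>R commutator K X Y Z"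
    if "affine_connection M \<A> E" and "\<And>U V. E' U V = E U V + c *\<^sub>R K U V" for E E' c
    by (rule curvature_add_scaled[OF that(1) _ _ _ _ that(2) XYZ])
      (simp_all add: K difference_tensor_closed[OF D Ds] difference_tensor_diff_left[OF D Ds]
        difference_tensor_add_right[OF D Ds] difference_tensor_scaleR_right[OF D Ds])
  have double: "V = (1/2) *\<^sub>R V + (1/2) *\<^sub>R V" for V :: "'a vfield"
    by (simp flip: scaleR_add_left)
  have D0_eq: "D0 U V = D U V + (1/2) *\<^sub>R K U V" for U V
    using double[of "D U V"]
    by (simp add: \<open>D0 = average_connection D Ds\<close> K average_connection_def difference_tensor_def
        algebra_simps)
  have Ds_eq: "Ds U V = D U V + 1 *\<^sub>R K U V" for U V
    by (simp add: K difference_tensor_def)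
  have D_eq0: "D U V = D0 U V + (- 1/2) *\<^sub>R K U V" for U V
    by (simp add: D0_eq)
  have Ds_eq0: "Ds U V = D0 U V + (1/2) *\<^sub>R K U V" for U V
    using double[of "K U V"] by (simp add: D0_eq Ds_eq add.assoc)
  define A0 where "A0 = cov_deriv D0 K X Y Z - cov_deriv D0 K Y X Z"
  define A where "A = cov_deriv D K X Y Z - cov_deriv D K Y X Z"
  define T0 where "T0 = K (torsion D0 X Y) Z"
  define T where "T = K (torsion D X Y) Z"
  define C where "C = commutator K X Y Z"
  note names = A0_def[symmetric] A_def[symmetric] T0_def[symmetric] T_def[symmetric]
    C_def[symmetric]
  have R: "curvature D X Y Z = curvature D0 X Y Z + (- 1/2) *\<^sub>R (A0 + T0) + (1/4) *\<^sub>R C"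
    using line[OF D0 D_eq0] by (simp add: names power2_eq_square)
  have Rs: "curvature Ds X Y Z = curvature D0 X Y Z + (1/2) *\<^sub>R (A0 + T0) + (1/4) *\<^sub>R C"
    using line[OF D0 Ds_eq0] by (simp add: names power2_eq_square)
  have Rs': "curvature Ds X Y Z = curvature D X Y Z + (A + T) + C"
    using line[OF D Ds_eq] by (simp add: names)
  note pointwise = fun_eq_iff scaleR_fun_def
  \<comment> \<open>The two expressions for the curvature of \<open>Ds\<close> relate the linear coefficients at \<open>D\<close> and
    at \<open>D0\<close>.\<close>
  have "A + T + C = curvature Ds X Y Z - curvature D X Y Z"
    unfolding Rs' by simp
  also have "\<dots> = A0 + T0"
    unfolding R Rs by (simp add: pointwise field_simps)
  finally have T: "T = A0 + T0 - C - A"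
    by (simp add: algebra_simps)
  show ?thesis
    unfolding names R Rs T by (simp add: pointwise field_simps)
qed

end
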